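(* Let $n\geq 3$ and let $\mathbb{P}=\mathrm{circ}(P_1,P_2,\ldots,P_n)$, where $P_k$ is the $k$th Pell number. Then $$\det(\mathbb{P})=(P_1-P_{n+1})^{n-2}(P_1-2P_n)+\sum_{k=2}^{n-1}\left[P_{k-1}P_n^{\,n-k}(P_1-P_{n+1})^{k-2}\right].$$
   Context: The Pell numbers are defined by $P_0=0$, $P_1=1$, and $P_k=2P_{k-1}+P_{k-2}$ for $k\geq 2$. For numbers $c_0,c_1,\ldots,c_{n-1}$, $\mathrm{circ}(c_0,c_1,\ldots,c_{n-1})$ denotes the $n\times n$ circulant matrix whose first row is $(c_0,c_1,\ldots,c_{n-1})$ and in which each subsequent row is the cyclic shift of the previous row one position to the right; i.e. its $(i,j)$ entry is $c_{(j-i)\bmod n}$ for $1\le i,j\le n$. *)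

theory Defs
  imports "Jordan_Normal_Form.Determinant"
begin

text \<open>The Pell numbers are taken as integers so that the differences in the determinant
  formula are not truncated.\<close>

fun pell :: "nat \<Rightarrow> int" where
  "pell 0 = 0"
| "pell (Suc 0) = 1"
| "pell (Suc (Suc k)) = 2 * pell (Suc k) + pell k"

text \<open>Matrix indices start at 0; since only the difference \<open>j - i\<close> matters, the entries
  agree with those for indices starting at 1. The difference is reduced over the integers
  because it may be negative.\<close>

definition circ :: "'a list \<Rightarrow> 'a mat" where
  "circ cs = mat (length cs) (length cs)
     (\<lambda>(i, j). cs ! nat ((int j - int i) mod int (length cs)))"

end

theory Submission
  imports Defs
begin

text \<open>Away from the wrap-around of the cyclic shift, the Pell recurrence says that a row of the
  circulant equals twice the next row plus the one after that. Multiplying on the left by the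
  upper unitriangular band matrix with bands \<open>1, -2, -1\<close> therefore leaves, in all rows
  but the last two, only the diagonal entry \<open>P\<^sub>1 - P\<^bsub>n+1\<^esub>\<close> and the superdiagonal entry \<open>-P\<^sub>n\<close>.
  In the last column only the corner entry \<open>P\<^sub>1 = 1\<close> survives, and expanding along it leaves a
  bidiagonal matrix bordered by one full row.\<close>

text \<open>The superdiagonal carries \<open>- y\<close> so that its powers absorb the cofactor
  signs and the determinant formula has none. The bottom row \<open>p\<close> is arbitrary, its
  corner entry \<open>p m\<close> included.\<close>

definition bordered_bidiagonal :: "nat \<Rightarrow> 'a::comm_ring_1 \<Rightarrow> 'a \<Rightarrow> (nat \<Rightarrow> 'a) \<Rightarrow> 'a mat" where
  "bordered_bidiagonal m x y p = mat (Suc m) (Suc m)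
     (\<lambda>(i, j). if i = m then p j else if j = i then x else if j = Suc i then - y else 0)"

text \<open>The first column is zero except at its two ends. Deleting the top row there leaves a
  matrix of the same shape with \<open>p\<close> shifted by one, which is why the induction
  generalizes \<open>p\<close>; deleting the bottom row leaves a triangular matrix.\<close>

lemma det_bordered_bidiagonal:
  "det (bordered_bidiagonal m x y p) = (\<Sum>j\<le>m. p j * x ^ j * y ^ (m - j))"
proof (induction m arbitrary: p)
  case 0
  show ?case
    by (subst det_single) (auto simp: bordered_bidiagonal_def)
next
  case (Suc m)
  let ?B = "bordered_bidiagonal (Suc m) x y p"
  have B: "?B \<in> carrier_mat (Suc (Suc m)) (Suc (Suc m))"
    by (simp add: bordered_bidiagonal_def)
  have top: "mat_delete ?B 0 0 = bordered_bidiagonal m x y (\<lambda>j. p (Suc j))"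
    by (rule eq_matI) (auto simp: mat_delete_def bordered_bidiagonal_def)
  let ?T = "mat_delete ?B (Suc m) 0"
  have T: "?T \<in> carrier_mat (Suc m) (Suc m)"
    by (rule carrier_matI) (simp_all add: bordered_bidiagonal_def)
  have diag: "diag_mat ?T = map (\<lambda>_. - y) [0..<Suc m]"
    unfolding diag_mat_def
    by (rule map_cong) (auto simp: mat_delete_def bordered_bidiagonal_def simp del: upt_Suc)
  \<comment> \<open>Without the first column, the entries \<open>- y\<close> move onto the diagonal
    and the entries \<open>x\<close> below it.\<close>
  have "det ?T = prod_list (diag_mat ?T)"
    by (rule det_lower_triangular[OF _ T])
      (auto simp: mat_delete_def bordered_bidiagonal_def)
  also have "\<dots> = (- y) ^ Suc m"
    unfolding diag map_replicate_const prod_list_replicate by simp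
  finally have detT: "det ?T = (- y) ^ Suc m" .
  have sign: "(- 1) ^ Suc m * (- y) ^ Suc m = y ^ Suc m"
    unfolding power_mult_distrib[symmetric] by simp
  have "det ?B = (\<Sum>i<Suc (Suc m). ?B $$ (i, 0) * cofactor ?B i 0)"
    by (rule laplace_expansion_column[OF B]) simp
  also have "\<dots> = (\<Sum>i\<in>{0, Suc m}. ?B $$ (i, 0) * cofactor ?B i 0)"
    by (rule sum.mono_neutral_right) (auto simp: bordered_bidiagonal_def)
  also have "\<dots> = x * det (mat_delete ?B 0 0) + p 0 * ((- 1) ^ Suc m * det ?T)"
    by (simp add: cofactor_def bordered_bidiagonal_def)
  also have "\<dots> = x * (\<Sum>j\<le>m. p (Suc j) * x ^ j * y ^ (m - j)) + p 0 * y ^ Suc m"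
    unfolding top Suc.IH detT sign ..
  also have "\<dots> = (\<Sum>j\<le>Suc m. p j * x ^ j * y ^ (Suc m - j))"
    by (subst sum.atMost_Suc_shift) (simp add: sum_distrib_left mult_ac add_ac)
  finally show ?case .
qed

text \<open>Writing an entry as a sum of one term per band makes an entry of a product split into
  three sums, each with a single nonzero term.\<close>

definition pell_band :: "nat \<Rightarrow> int mat" where
  "pell_band n = mat n n (\<lambda>(i, j).
     (if j = i then 1 else 0) + (if j = i + 1 then - 2 else 0) + (if j = i + 2 then - 1 else 0))"

lemma det_pell_band: "det (pell_band n) = 1"
proof -
  have "diag_mat (pell_band n) = replicate n 1"
    by (rule nth_equalityI) (auto simp: diag_mat_def pell_band_def)
  moreover have "det (pell_band n) = prod_list (diag_mat (pell_band n))"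
    by (rule det_upper_triangular[of _ n]) (auto simp: pell_band_def)
  ultimately show ?thesis
    by simp
qed

lemma pell_band_mult_index:
  assumes "C \<in> carrier_mat n n" "i < n" "j < n"
  shows "(pell_band n * C) $$ (i, j) = C $$ (i, j)
    - (if i + 1 < n then 2 * C $$ (i + 1, j) else 0) - (if i + 2 < n then C $$ (i + 2, j) else 0)"
proof -
  have "(pell_band n * C) $$ (i, j) = (\<Sum>k<n.
      ((if k = i then 1 else 0) + (if k = i + 1 then - 2 else 0) + (if k = i + 2 then - 1 else 0))
      * C $$ (k, j))"
    using assms by (simp add: pell_band_def scalar_prod_def lessThan_atLeast0)
  also have "\<dots> = (\<Sum>k<n. (if k = i then C $$ (k, j) else 0)
      + (if k = i + 1 then - 2 * C $$ (k, j) else 0) + (if k = i + 2 then - C $$ (k, j) else 0))"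
    by (rule sum.cong) auto
  also have "\<dots> = C $$ (i, j)
    - (if i + 1 < n then 2 * C $$ (i + 1, j) else 0) - (if i + 2 < n then C $$ (i + 2, j) else 0)"
    using assms by (simp add: sum.distrib)
  finally show ?thesis .
qed

lemma circ_index:
  assumes "i < length cs" "j < length cs"
  shows "circ cs $$ (i, j) = cs ! (if i \<le> j then j - i else length cs + j - i)"
proof (cases "i \<le> j")
  case True
  then have "(int j - int i) mod int (length cs) = int (j - i)"
    using assms by (simp add: of_nat_diff)
  then show ?thesis
    using assms True by (simp add: circ_def del: of_nat_diff)
next
  case False
  have "(int j - int i) mod int (length cs) = (int j - int i + int (length cs)) mod int (length cs)"
    by simp
  also have "\<dots> = int (length cs + j - i)"
    using assms False by (subst mod_pos_pos_trivial) auto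
  finally show ?thesis
    using assms False by (simp add: circ_def del: of_nat_diff)
qed

definition circ_pell :: "nat \<Rightarrow> int mat" where
  "circ_pell n = circ (map pell [1..<n + 1])"

lemma circ_pell_carrier: "circ_pell n \<in> carrier_mat n n"
  by (rule carrier_matI) (simp_all add: circ_pell_def circ_def)

lemma circ_pell_index:
  assumes "i < n" "j < n"
  shows "circ_pell n $$ (i, j)
    = pell (if i \<le> j then Suc (j - i) else Suc (n + j - i))"
proof -
  have "circ_pell n $$ (i, j)
      = map pell [1..<n + 1] ! (if i \<le> j then j - i else n + j - i)"
    unfolding circ_pell_def using assms by (subst circ_index) (auto simp del: upt_Suc)
  also have "\<dots> = pell (if i \<le> j then Suc (j - i) else Suc (n + j - i))"
    using assms by (subst nth_map) (auto simp del: upt_Suc)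
  finally show ?thesis .
qed

lemma pell_step: "k \<ge> 2 \<Longrightarrow> pell k = 2 * pell (k - 1) + pell (k - 2)"
  by (cases k rule: pell.cases) auto

text \<open>No wrap-around occurs in the last column: from top to bottom it reads P_n, ..., P_1, so
  the recurrence kills every entry but the last.\<close>

lemma pell_band_mult_circ_last_column:
  assumes "n \<ge> 3" "i < n"
  shows "(pell_band n * circ_pell n) $$ (i, n - 1) = (if i = n - 1 then 1 else 0)"
proof -
  let ?C = "circ_pell n"
  note C = circ_pell_carrier[of n]
  have entry: "?C $$ (k, n - 1) = pell (n - k)" if "k < n" for k
    using that by (subst circ_pell_index) (auto simp: Suc_diff_le[symmetric] simp del: pell.simps)
  have "(pell_band n * ?C) $$ (i, n - 1) = pell (n - i)
      - (if i + 1 < n then 2 * pell (n - (i + 1)) else 0)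
      - (if i + 2 < n then pell (n - (i + 2)) else 0)"
    using assms by (subst pell_band_mult_index[OF C]) (auto simp: entry simp del: One_nat_def)
  also have "\<dots> = pell (n - i) - 2 * pell (n - i - 1) - pell (n - i - 2)"
    by auto
  also have "\<dots> = (if i = n - 1 then 1 else 0)"
    using assms by (cases "n - i" rule: pell.cases) auto
  finally show ?thesis .
qed

lemma mat_delete_pell_band_mult_circ:
  assumes "n \<ge> 3"
  shows "mat_delete (pell_band n * circ_pell n) (n - 1) (n - 1)
    = bordered_bidiagonal (n - 2) (pell 1 - pell (n + 1)) (pell n)
        (\<lambda>j. if j = n - 2 then pell 1 - 2 * pell n else pell (Suc j))"
    (is "?D = ?B")
proof (rule eq_matI)
  let ?C = "circ_pell n"
  note C = circ_pell_carrier[of n]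
  have band: "pell_band n \<in> carrier_mat n n"
    by (simp add: pell_band_def)
  show "dim_row ?D = dim_row ?B" "dim_col ?D = dim_col ?B"
    using C band assms by (auto simp: mat_delete_def bordered_bidiagonal_def)
  fix i j
  assume "i < dim_row ?B" "j < dim_col ?B"
  then have ij: "i < n - 1" "j < n - 1"
    using assms by (auto simp: bordered_bidiagonal_def)
  have "?D $$ (i, j) = (pell_band n * ?C) $$ (i, j)"
    using C band ij by (auto simp: mat_delete_def)
  also have "\<dots> = ?C $$ (i, j) - 2 * ?C $$ (i + 1, j) - (if i + 2 < n then ?C $$ (i + 2, j) else 0)"
    using ij by (subst pell_band_mult_index[OF C]) auto
  also have "\<dots> = ?B $$ (i, j)"
  \<comment> \<open>In this row the third band leaves the matrix. Left of the diagonal the result is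
    P_(j+3) - 2 P_(j+2) = P_(j+1), and on it P_1 - 2 P_n.\<close>
  proof (cases "i = n - 2")
    case True
    show ?thesis
    proof (cases "j = n - 2")
      case True
      with \<open>i = n - 2\<close> assms show ?thesis
        by (simp add: circ_pell_index bordered_bidiagonal_def Suc_diff_Suc numeral_2_eq_2)
    next
      case False
      then have "\<not> i \<le> j" "Suc (n + j - i) = Suc (Suc (Suc j))"
        "Suc (n + j - (i + 1)) = Suc (Suc j)"
        using ij True by auto
      then show ?thesis
        using True False ij assms by (simp add: circ_pell_index bordered_bidiagonal_def)
    qed
  next
    case False
    then have i: "i + 2 < n"
      using ij by auto
    \<comment> \<open>The cases record how many of the entries in rows \<open>i\<close>,
      \<open>i + 1\<close>, \<open>i + 2\<close> of column \<open>j\<close> are wrapped around: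
      three, two, one or none. The recurrence gives 0 in the first and last. The second gives P_1 -
      2 P_n - P_(n-1) = P_1 - P_(n+1), the third P_2 - 2 P_1 - P_n = - P_n.\<close>
    consider "j < i" | "j = i" | "j = Suc i" | "j \<ge> i + 2"
      by linarith
    then show ?thesis
    proof cases
      case 1
      have "pell (Suc (n + j - i)) = 2 * pell (n + j - i) + pell (n + j - i - 1)"
        using pell_step[of "Suc (n + j - i)"] i by simp
      moreover have "?C $$ (i, j) = pell (Suc (n + j - i))" "?C $$ (i + 1, j) = pell (n + j - i)"
        "?C $$ (i + 2, j) = pell (n + j - i - 1)"
        using 1 i ij by (simp_all add: circ_pell_index Suc_diff_Suc del: pell.simps)
      ultimately have "?C $$ (i, j) - 2 * ?C $$ (i + 1, j) - ?C $$ (i + 2, j) = 0"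
        by linarith
      then show ?thesis
        using 1 i ij by (simp add: bordered_bidiagonal_def)
    next
      case 2
      have "pell (n + 1) = 2 * pell n + pell (n - 1)"
        using pell_step[of "n + 1"] assms by simp
      moreover have "Suc (n - 2) = n - 1"
        using i by auto
      ultimately show ?thesis
        using 2 False i ij by (simp add: circ_pell_index bordered_bidiagonal_def)
    next
      case 3
      then show ?thesis
        using False i ij by (simp add: circ_pell_index bordered_bidiagonal_def)
    next
      case 4
      have "pell (Suc (j - i)) = 2 * pell (j - i) + pell (j - i - 1)"
        using pell_step[of "Suc (j - i)"] 4 by simp
      moreover have "?C $$ (i, j) = pell (Suc (j - i))" "?C $$ (i + 1, j) = pell (j - i)"
        "?C $$ (i + 2, j) = pell (j - i - 1)"
        using 4 i ij by (simp_all add: circ_pell_index Suc_diff_Suc del: pell.simps)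
      ultimately have "?C $$ (i, j) - 2 * ?C $$ (i + 1, j) - ?C $$ (i + 2, j) = 0"
        by linarith
      then show ?thesis
        using 4 i ij by (simp add: bordered_bidiagonal_def)
    qed
  qed
  finally show "?D $$ (i, j) = ?B $$ (i, j)" .
qed

theorem theorem1:
  fixes n :: nat
  assumes "n \<ge> 3"
  shows "det (circ (map pell [1..<n + 1])) =
    (pell 1 - pell (n + 1)) ^ (n - 2) * (pell 1 - 2 * pell n)
    + (\<Sum>k = 2..n - 1. pell (k - 1) * pell n ^ (n - k) * (pell 1 - pell (n + 1)) ^ (k - 2))"
proof -
  let ?C = "circ_pell n"
  let ?M = "pell_band n * ?C"
  let ?x = "pell 1 - pell (n + 1)"
  let ?p = "\<lambda>j. if j = n - 2 then pell 1 - 2 * pell n else pell (Suc j)"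
  note C = circ_pell_carrier[of n]
  have band: "pell_band n \<in> carrier_mat n n"
    by (simp add: pell_band_def)
  have M: "?M \<in> carrier_mat n n"
    using band C by simp
  have "det ?C = det ?M"
    by (simp add: det_mult[OF band C] det_pell_band)
  also have "\<dots> = (\<Sum>i<n. ?M $$ (i, n - 1) * cofactor ?M i (n - 1))"
    using assms by (intro laplace_expansion_column[OF M]) simp
  also have "\<dots> = (\<Sum>i<n. if i = n - 1 then cofactor ?M i (n - 1) else 0)"
    by (rule sum.cong) (auto simp: pell_band_mult_circ_last_column[OF assms] simp del: One_nat_def)
  also have "\<dots> = det (mat_delete ?M (n - 1) (n - 1))"
    using assms by (simp add: cofactor_def)
  also have "\<dots> = (\<Sum>j\<le>n - 2. ?p j * ?x ^ j * pell n ^ (n - 2 - j))"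
    unfolding mat_delete_pell_band_mult_circ[OF assms] det_bordered_bidiagonal ..
  \<comment> \<open>The term with the exceptional corner value of \<open>?p\<close> becomes the
    separate product in the formula.\<close>
  also have "\<dots> = ?p (n - 2) * ?x ^ (n - 2)
      + (\<Sum>j<n - 2. ?p j * ?x ^ j * pell n ^ (n - 2 - j))"
    by (simp add: lessThan_Suc_atMost[symmetric])
  also have "(\<Sum>j<n - 2. ?p j * ?x ^ j * pell n ^ (n - 2 - j))
      = (\<Sum>k = 2..n - 1. pell (k - 1) * pell n ^ (n - k) * ?x ^ (k - 2))"
    \<comment> \<open>With \<open>k = j + 2\<close>, the entry \<open>pell (Suc j)\<close> is
      \<open>pell (k - 1)\<close> and the exponent \<open>n - 2 - j\<close> is
      \<open>n - k\<close>.\<close>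
    by (rule sum.reindex_bij_witness[of _ "\<lambda>k. k - 2" "\<lambda>j. j + 2"]) (auto simp: mult_ac)
  finally show ?thesis
    unfolding circ_pell_def by (simp add: mult_ac)
qed

end
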